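(* Let $n\ge2$. There exists a continuous map $\varphi:\mathcal K_0^n\times[0,1]\to\mathcal K_0^n$ such that $\varphi(A,0)=A$ and $\varphi(A,1)=\mathbb B$ for all $A\in\mathcal K_0^n$, and $\varphi(A^\circ,t)=\varphi(A,t)^\circ$ for all $A\in\mathcal K_0^n$ and $t\in[0,1]$. That is, $\mathcal K_0^n$ with the $\mathbb Z_2$-action given by the polar mapping $A\mapsto A^\circ$ is $\mathbb Z_2$-contractible to its fixed point $\mathbb B$.
   Context: $\mathbb B$ is the closed Euclidean unit ball of $\mathbb R^n$. $\mathcal K_0^n$ is the family of closed convex subsets of $\mathbb R^n$ containing $0$, with the Attouch–Wets metric $d_{AW}(A,K)=\sup_{j\in\mathbb N}\min\{\frac1j,\sup_{\|x\|<j}|d(x,A)-d(x,K)|\}$, $d(x,A)=\inf_{a\in A}\|x-a\|$. The polar of $A$ is $A^\circ=\{x:\sup_{a\in A}\langle a,x\rangle\le1\}$; the polar mapping $A\mapsto A^\circ$ is an involution of $\mathcal K_0^n$ whose unique fixed point is $\mathbb B$. *)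

theory Defs
  imports "HOL-Analysis.Analysis"
begin

definition K0 :: "(real^'n) set set" where
  "K0 = {A. closed A \<and> convex A \<and> 0 \<in> A}"

definition dAW :: "(real^'n) set \<Rightarrow> (real^'n) set \<Rightarrow> real" where
  "dAW A K = (SUP j\<in>{1::nat..}. min (1 / real j)
                 (SUP x\<in>ball 0 (real j). \<bar>infdist x A - infdist x K\<bar>))"

definition polar :: "(real^'n) set \<Rightarrow> (real^'n) set" where
  "polar A = {x. \<forall>a\<in>A. inner a x \<le> 1}"

end

theory Submission
  imports Defs
begin

text \<open>If \<open>f\<close> is half the squared gauge of \<open>A\<close>, its Legendre conjugate is half the squared gauge of
  the polar of \<open>A\<close>. The proximal average commutes with conjugation and preserves 2-homogeneity,
  and half the squared norm is self-conjugate, so moving \<open>f\<close> to it along proximal averages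
  contracts equivariantly to the unit ball.

  For continuity, \<open>dAW\<close>-convergence is Painleve-Kuratowski convergence. Polarity exchanges its lower
  and upper halves, so equivariance reduces the claim to the lower half, that is, to perturbing a
  single point of the average.\<close>

section \<open>Polars and the bipolar theorem\<close>

lemma mem_polar_iff: "y \<in> polar A \<longleftrightarrow> (\<forall>a\<in>A. a \<bullet> y \<le> 1)"
  by (simp add: polar_def)

lemma polar_in_K0: "polar A \<in> K0"
proof -
  have *: "polar A = (\<Inter>a\<in>A. {x. a \<bullet> x \<le> 1})" by (auto simp: polar_def)
  show ?thesis unfolding K0_def *
    by (auto intro!: closed_INT convex_INT closed_halfspace_le convex_halfspace_le)
qed

lemma bipolar:
  assumes "A \<in> K0" shows "polar (polar A) = A"
proof
  show "A \<subseteq> polar (polar A)"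
    by (auto simp: mem_polar_iff) (metis inner_commute)
  show "polar (polar A) \<subseteq> A"
  proof (rule ccontr)
    assume "\<not> polar (polar A) \<subseteq> A"
    then obtain z where z: "z \<in> polar (polar A)" "z \<notin> A" by auto
    have A: "convex A" "closed A" "0 \<in> A" using assms by (auto simp: K0_def)
    obtain a b where ab: "a \<bullet> z < b" "\<And>x. x \<in> A \<Longrightarrow> b < a \<bullet> x"
      using separating_hyperplane_closed_point[OF A(1,2) z(2)] by auto
    \<comment> \<open>Since 0 lies in A, b is negative, so dividing by b reverses both inequalities:
      \<open>u\<close> stays below 1 on A but exceeds 1 at z.\<close>
    have "b < 0" using ab(2)[OF A(3)] by simp
    define u where "u = (1 / b) *\<^sub>R a"
    have "u \<in> polar A"
      unfolding mem_polar_iff u_def using ab(2) \<open>b < 0\<close>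
      by (auto simp: inner_commute field_simps intro: less_imp_le)
    moreover have "u \<bullet> z > 1"
      unfolding u_def using ab(1) \<open>b < 0\<close> by (simp add: field_simps)
    ultimately show False using z(1) by (auto simp: mem_polar_iff[of z])
  qed
qed

section \<open>Gauges and Moreau's decomposition\<close>

text \<open>The relation \<open>gauge A a \<le> r\<close>, written through the support function of the polar so that
  infinite and vanishing gauges need no special treatment.\<close>

definition gauge_le :: "(real^'n) set \<Rightarrow> real^'n \<Rightarrow> real \<Rightarrow> bool" where
  "gauge_le A a r \<longleftrightarrow> (\<forall>u\<in>polar A. a \<bullet> u \<le> r)"

lemma gauge_le_nonneg: "gauge_le A a r \<Longrightarrow> 0 \<le> r"
  unfolding gauge_le_def using polar_in_K0[of A] by (force simp: K0_def)

lemma gauge_le_mono: "gauge_le A a r \<Longrightarrow> r \<le> s \<Longrightarrow> gauge_le A a s"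
  unfolding gauge_le_def by fastforce

lemma gauge_le_scale: "gauge_le A a r \<Longrightarrow> 0 \<le> c \<Longrightarrow> gauge_le A (c *\<^sub>R a) (c * r)"
  unfolding gauge_le_def by (simp add: mult_left_mono)

lemma gauge_le_mem_scaled:
  assumes "A \<in> K0" "gauge_le A a r" "0 < r"
  shows "(1 / r) *\<^sub>R a \<in> A"
proof -
  have "(1 / r) *\<^sub>R a \<in> polar (polar A)"
    using assms(2,3) by (auto simp: gauge_le_def mem_polar_iff inner_commute)
  then show ?thesis using bipolar[OF assms(1)] by simp
qed

lemma gauge_le_mem: "a \<in> A \<Longrightarrow> gauge_le A a 1"
  by (auto simp: gauge_le_def mem_polar_iff)

lemma gauge_le_one_iff: "A \<in> K0 \<Longrightarrow> gauge_le A a 1 \<longleftrightarrow> a \<in> A"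
  using gauge_le_mem_scaled[of A a 1] gauge_le_mem by auto

text \<open>Cauchy-Schwarz for dual gauges. If t exceeds s, then c divided by t lies in the polar of
  A, which gives the bound \<open>r * t\<close>; letting t decrease to s also covers s = 0, where
  division by s is impossible.\<close>

lemma gauge_le_inner:
  assumes a: "gauge_le A a r" and c: "gauge_le (polar A) c s"
  shows "a \<bullet> c \<le> r * s"
proof -
  have *: "a \<bullet> c \<le> r * t" if "s < t" for t
  proof -
    have "0 < t" using that gauge_le_nonneg[OF c] by simp
    have "(1 / t) *\<^sub>R c \<in> polar A"
      using gauge_le_mem_scaled[OF polar_in_K0 gauge_le_mono[OF c] \<open>0 < t\<close>] that by simp
    then have "a \<bullet> ((1 / t) *\<^sub>R c) \<le> r" using a unfolding gauge_le_def by blast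
    then show ?thesis using \<open>0 < t\<close> by (simp add: field_simps)
  qed
  have "((\<lambda>t. r * t) \<longlongrightarrow> r * s) (at_right s)"
    by (intro tendsto_intros)
  then show ?thesis
    by (rule tendsto_lowerbound) (auto simp: * eventually_at_filter)
qed

text \<open>Moreau's decomposition of \<open>(z, 0)\<close> with respect to the cone of all \<open>(p, k r)\<close> with
  \<open>gauge A p \<le> r\<close>; in terms of \<open>f = gauge\<^sup>2 / 2\<close> it says that \<open>I + k\<^sup>2 \<partial>f\<close> is surjective.\<close>

lemma gauge_resolvent:
  fixes A :: "(real^'n) set"
  assumes A: "A \<in> K0" and k: "0 < k"
  obtains p u r where "z = p + k\<^sup>2 *\<^sub>R u" "gauge_le A p r" "gauge_le (polar A) u r" "p \<bullet> u = r\<^sup>2"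
proof -
  define S where "S = {x :: (real^'n) \<times> real. \<forall>u\<in>polar A. k * (fst x \<bullet> u) \<le> snd x}"
  have S: "S = (\<Inter>u\<in>polar A. {x. (k *\<^sub>R u, -1) \<bullet> x \<le> 0})"
    by (auto simp: S_def inner_prod_def inner_commute)
  have cl: "closed S" and cv: "convex S"
    unfolding S by (auto intro!: closed_INT convex_INT closed_halfspace_le convex_halfspace_le)
  have zero: "0 \<in> S" by (simp add: S_def)
  define x where "x = closest_point S (z, 0)"
  obtain p q where pq: "x = (p, q)" by (cases x)
  have xS: "x \<in> S" unfolding x_def using cl zero by (intro closest_point_in_set) auto
  have dot: "((z, 0) - x) \<bullet> (y - x) \<le> 0" if "y \<in> S" for y
    unfolding x_def using closest_point_dot[OF cv cl that] .
  \<comment> \<open>\<open>S\<close> is a cone, so the projection x can be compared with both 2x and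
    0. This makes the residual orthogonal to x and hence places it in the polar cone.\<close>
  have "2 *\<^sub>R x \<in> S" using xS by (auto simp: S_def)
  from dot[OF this] have "((z, 0) - x) \<bullet> x \<le> 0" by (simp add: scaleR_2)
  moreover from dot[OF zero] have "((z, 0) - x) \<bullet> x \<ge> 0" by simp
  ultimately have orth: "((z, 0) - x) \<bullet> x = 0" by simp
  have dot': "((z, 0) - x) \<bullet> y \<le> 0" if "y \<in> S" for y
    using dot[OF that] orth by (simp add: inner_diff_right)
  show thesis
  proof
    show "z = p + k\<^sup>2 *\<^sub>R ((1 / k\<^sup>2) *\<^sub>R (z - p))" using k by simp
    show "gauge_le A p (q / k)"
      using xS k by (auto simp: gauge_le_def S_def pq field_simps)
    show "gauge_le (polar A) ((1 / k\<^sup>2) *\<^sub>R (z - p)) (q / k)"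
      unfolding gauge_le_def bipolar[OF A]
    proof
      \<comment> \<open>The residual is (z - p, -q); testing it against the cone points (a, k)
        bounds z - p on A by q k.\<close>
      fix a assume "a \<in> A"
      then have "(a, k) \<in> S"
        using k by (auto simp: S_def mem_polar_iff)
      from dot'[OF this] have "(z - p) \<bullet> a \<le> q * k"
        by (simp add: pq)
      then have "(1 / k\<^sup>2) * ((z - p) \<bullet> a) \<le> (1 / k\<^sup>2) * (q * k)"
        by (intro mult_left_mono) auto
      also have "\<dots> = q / k" by (simp add: power2_eq_square)
      finally show "((1 / k\<^sup>2) *\<^sub>R (z - p)) \<bullet> a \<le> q / k" by simp
    qed
    have "p \<bullet> (z - p) = q\<^sup>2"
      using orth by (simp add: pq inner_commute power2_eq_square)
    then show "p \<bullet> ((1 / k\<^sup>2) *\<^sub>R (z - p)) = (q / k)\<^sup>2"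
      by (simp add: power_divide)
  qed
qed

section \<open>The proximal average with the Euclidean ball\<close>

text \<open>The unit sublevel set of twice the proximal average of \<open>gauge\<^sup>2 / 2\<close> and \<open>norm\<^sup>2 / 2\<close>.\<close>

definition prox_energy :: "real \<Rightarrow> real^'n \<Rightarrow> real^'n \<Rightarrow> real \<Rightarrow> real" where
  "prox_energy t a b r = (1 - t) * r\<^sup>2 + t * (b \<bullet> b) + t * (1 - t) * ((a - b) \<bullet> (a - b))"

definition prox_shrink :: "(real^'n) set \<Rightarrow> real \<Rightarrow> (real^'n) set" where
  "prox_shrink A t = {(1 - t) *\<^sub>R a + t *\<^sub>R b | a b r. gauge_le A a r \<and> prox_energy t a b r \<le> 1}"

lemma prox_shrinkI:
  "gauge_le A a r \<Longrightarrow> prox_energy t a b r \<le> 1 \<Longrightarrow> (1 - t) *\<^sub>R a + t *\<^sub>R b \<in> prox_shrink A t"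
  unfolding prox_shrink_def by blast

lemma prox_shrink_0:
  assumes "A \<in> K0" shows "prox_shrink A 0 = A"
proof
  show "prox_shrink A 0 \<subseteq> A"
  proof
    fix a assume "a \<in> prox_shrink A 0"
    then obtain r where "gauge_le A a r" "r \<le> 1"
      by (auto simp: prox_shrink_def prox_energy_def abs_square_le_1)
    then show "a \<in> A" using gauge_le_mono gauge_le_one_iff[OF assms] by blast
  qed
  show "A \<subseteq> prox_shrink A 0"
    using prox_shrinkI[of A _ 1 0 0] by (auto simp: prox_energy_def gauge_le_mem)
qed

lemma prox_shrink_1: "0 \<in> A \<Longrightarrow> prox_shrink A 1 = cball 0 1"
  using gauge_le_mem[of 0 A]
  by (auto simp: prox_shrink_def prox_energy_def dot_square_norm abs_square_le_1)

lemma prox_energy_scale: "prox_energy t (c *\<^sub>R a) (c *\<^sub>R b) (c * r) = c\<^sup>2 * prox_energy t a b r"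
  by (simp add: prox_energy_def power_mult_distrib algebra_simps power2_eq_square inner_diff)

lemma prox_shrink_scaleI:
  assumes "gauge_le A a r" "0 \<le> c" "c\<^sup>2 * prox_energy t a b r \<le> 1"
  shows "c *\<^sub>R ((1 - t) *\<^sub>R a + t *\<^sub>R b) \<in> prox_shrink A t"
  using prox_shrinkI[OF gauge_le_scale[OF assms(1,2)], of t "c *\<^sub>R b"] assms(3)
  by (simp add: prox_energy_scale scaleR_add_right mult.commute)

section \<open>Equivariance under polarity\<close>

lemma two_inner_le: "2 * (x \<bullet> y) \<le> x \<bullet> x + y \<bullet> (y :: 'a :: real_inner)"
  using inner_ge_zero[of "x - y"] by (simp add: inner_diff inner_commute)

text \<open>Fenchel-Young: 2 (x . y) splits into three inner products, each bounded by the matching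
  terms of the two energies. Taking \<open>d - c\<close> against \<open>a - b\<close> gives the
  mixed products a . d and b . c the right sign.\<close>

lemma prox_shrink_polar_inner:
  assumes t: "t \<in> {0..1}" and x: "x \<in> prox_shrink A t" and y: "y \<in> prox_shrink (polar A) t"
  shows "x \<bullet> y \<le> 1"
proof -
  obtain a b r where 1: "x = (1 - t) *\<^sub>R a + t *\<^sub>R b" "gauge_le A a r" "prox_energy t a b r \<le> 1"
    using x by (auto simp: prox_shrink_def)
  obtain c d s where 2: "y = (1 - t) *\<^sub>R c + t *\<^sub>R d" "gauge_le (polar A) c s" "prox_energy t c d s \<le> 1"
    using y by (auto simp: prox_shrink_def)
  have "2 * (x \<bullet> y) = (1 - t) * (2 * (a \<bullet> c)) + t * (2 * (b \<bullet> d))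
      + t * (1 - t) * (2 * ((a - b) \<bullet> (d - c)))"
    unfolding 1 2 by (simp add: algebra_simps inner_diff inner_add power2_eq_square)
  also have "\<dots> \<le> (1 - t) * (r\<^sup>2 + s\<^sup>2) + t * (b \<bullet> b + d \<bullet> d)
      + t * (1 - t) * ((a - b) \<bullet> (a - b) + (d - c) \<bullet> (d - c))"
  proof (intro add_mono mult_left_mono two_inner_le)
    show "2 * (a \<bullet> c) \<le> r\<^sup>2 + s\<^sup>2"
      using gauge_le_inner[OF 1(2) 2(2)] sum_squares_bound[of r s] by simp
  qed (use t in auto)
  also have "\<dots> = prox_energy t a b r + prox_energy t c d s"
    unfolding prox_energy_def by (simp add: algebra_simps inner_diff)
  finally show ?thesis using 1 2 by simp
qed

text \<open>The pairs \<open>(p, u)\<close> with \<open>u \<in> \<partial>f p\<close> are moved to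
  \<open>((1 - t/2) p + t/2 u, (1 - t/2) u + t/2 p)\<close>. Polarity swaps the two entries.\<close>

lemma prox_energy_dual_pair:
  assumes "p \<bullet> u = r\<^sup>2"
  shows "prox_energy t p ((1/2) *\<^sub>R (p + u)) r
       = ((1 - t) *\<^sub>R p + t *\<^sub>R ((1/2) *\<^sub>R (p + u))) \<bullet> ((1 - t) *\<^sub>R u + t *\<^sub>R ((1/2) *\<^sub>R (p + u)))"
proof -
  have "u \<bullet> p = r\<^sup>2" using assms by (simp add: inner_commute)
  then show ?thesis
    by (simp add: prox_energy_def algebra_simps inner_diff inner_add assms
        power2_eq_square[of t] flip: add_divide_distrib) (simp add: field_simps)
qed

text \<open>Surjectivity of the resolvent writes y as the second entry of a moved dual pair (x, y),
  whose inner product is the energy E of both entries. If E exceeded 1, then x / sqrt E would lie in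
  \<open>prox_shrink A t\<close> and pair with y to sqrt E > 1.\<close>

lemma polar_prox_shrink_subset:
  assumes A: "A \<in> K0" and t: "0 < t" "t < 1"
  shows "polar (prox_shrink A t) \<subseteq> prox_shrink (polar A) t"
proof
  fix y assume y: "y \<in> polar (prox_shrink A t)"
  \<comment> \<open>The square of k is the ratio of the coefficients 1 - t/2 of u and t/2 of p in
    the desired form of y.\<close>
  define k where "k = sqrt ((2 - t) / t)"
  have k: "0 < k" "k\<^sup>2 = (2 - t) / t" using t by (auto simp: k_def)
  obtain p u r where pu: "(2 / t) *\<^sub>R y = p + k\<^sup>2 *\<^sub>R u" "gauge_le A p r"
      "gauge_le (polar A) u r" "p \<bullet> u = r\<^sup>2"
    using gauge_resolvent[OF A k(1), of "(2 / t) *\<^sub>R y"] by metis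
  define m where "m = (1/2) *\<^sub>R (p + u)"
  have "y = (t / 2) *\<^sub>R ((2 / t) *\<^sub>R y)" using t by simp
  also have "\<dots> = (t / 2) *\<^sub>R p + ((t / 2) * k\<^sup>2) *\<^sub>R u"
    unfolding pu(1) by (simp add: scaleR_add_right)
  also have "(t / 2) * k\<^sup>2 = 1 - t / 2" using t by (simp add: k field_simps)
  also have "(t / 2) *\<^sub>R p + (1 - t / 2) *\<^sub>R u = (1 - t) *\<^sub>R u + t *\<^sub>R m"
    by (simp add: m_def vec_eq_iff field_simps)
  finally have y_eq: "y = (1 - t) *\<^sub>R u + t *\<^sub>R m" .
  define E where "E = prox_energy t p m r"
  have E: "E = ((1 - t) *\<^sub>R p + t *\<^sub>R m) \<bullet> y"
    unfolding E_def y_eq m_def using prox_energy_dual_pair[OF pu(4)] .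
  \<comment> \<open>m is the midpoint of p and u, so exchanging them only changes the sign of p -
    m.\<close>
  have E': "prox_energy t u m r = E"
    unfolding E_def m_def prox_energy_def
    by (simp add: algebra_simps inner_diff inner_add inner_commute)
  have "E \<le> 1"
  proof (rule ccontr)
    assume "\<not> E \<le> 1"
    then have "1 < E" by simp
    then have "(1 / sqrt E) *\<^sub>R ((1 - t) *\<^sub>R p + t *\<^sub>R m) \<in> prox_shrink A t"
      by (intro prox_shrink_scaleI[OF pu(2)]) (auto simp: E_def[symmetric] power_divide)
    then have "(1 / sqrt E) * E \<le> 1"
      using y unfolding mem_polar_iff E by fastforce
    then have "sqrt E \<le> 1" using \<open>1 < E\<close> by (simp add: real_div_sqrt)
    then show False using \<open>1 < E\<close> by simp
  qed
  then show "y \<in> prox_shrink (polar A) t"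
    unfolding y_eq using prox_shrinkI[OF pu(3)] E' by simp
qed

lemma polar_cball: "polar (cball 0 1 :: (real^'n) set) = cball 0 1"
proof
  show "polar (cball 0 1 :: (real^'n) set) \<subseteq> cball 0 1"
  proof
    fix y :: "real^'n" assume "y \<in> polar (cball 0 1)"
    then have "sgn y \<bullet> y \<le> 1" by (auto simp: mem_polar_iff norm_sgn)
    moreover have "sgn y \<bullet> y = norm y"
      by (cases "y = 0") (simp_all add: sgn_div_norm dot_square_norm power2_eq_square flip: mult.assoc)
    ultimately show "y \<in> cball 0 1" by simp
  qed
  show "cball 0 1 \<subseteq> polar (cball 0 1 :: (real^'n) set)"
  proof (clarsimp simp: mem_polar_iff)
    fix y a :: "real^'n" assume "norm y \<le> 1" "norm a \<le> 1"
    then show "a \<bullet> y \<le> 1"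
      using norm_cauchy_schwarz[of a y] mult_mono[of "norm a" 1 "norm y" 1] by simp
  qed
qed

lemma prox_shrink_polar:
  assumes A: "A \<in> K0" and t: "t \<in> {0..1}"
  shows "prox_shrink (polar A) t = polar (prox_shrink A t)"
proof -
  \<comment> \<open>The resolvent parameter (2 - t) / t degenerates at t = 0; both endpoints are
    computed directly.\<close>
  consider "t = 0" | "t = 1" | "0 < t" "t < 1" using t by fastforce
  then show ?thesis
  proof cases
    case 3
    then have "polar (prox_shrink A t) \<subseteq> prox_shrink (polar A) t"
      using polar_prox_shrink_subset[OF A] by simp
    moreover have "prox_shrink (polar A) t \<subseteq> polar (prox_shrink A t)"
      using prox_shrink_polar_inner[OF t] by (auto simp: mem_polar_iff)
    ultimately show ?thesis by blast
  next
    case 2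
    then show ?thesis
      using A polar_in_K0[of A] by (simp add: prox_shrink_1 K0_def polar_cball)
  qed (use A in \<open>simp add: prox_shrink_0 polar_in_K0\<close>)
qed

text \<open>Equivariance, applied to the polar of A, exhibits the set as a polar, and every polar is
  closed, convex and contains 0.\<close>

lemma prox_shrink_in_K0:
  assumes "A \<in> K0" "t \<in> {0..1}" shows "prox_shrink A t \<in> K0"
  using prox_shrink_polar[OF polar_in_K0 assms(2), of A] bipolar[OF assms(1)] polar_in_K0 by metis

section \<open>Attouch-Wets convergence and distance functions\<close>

lemma infdist_diff_le_norm:
  fixes A B :: "'a::real_normed_vector set"
  assumes "0 \<in> A" "0 \<in> B" shows "\<bar>infdist x A - infdist x B\<bar> \<le> norm x"
  using infdist_le[OF assms(1), of x] infdist_le[OF assms(2), of x]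
    infdist_nonneg[of x A] infdist_nonneg[of x B] by simp

text \<open>A real supremum is known to be an upper bound only for bounded families. The common
  point 0 bounds the inner supremum of \<open>dAW\<close>; the truncation 1/j bounds the outer
  one.\<close>

lemma bdd_above_infdist_diff:
  fixes A B :: "'a::real_normed_vector set"
  assumes "0 \<in> A" "0 \<in> B"
  shows "bdd_above ((\<lambda>x. \<bar>infdist x A - infdist x B\<bar>) ` ball 0 r)"
proof (rule bdd_aboveI2)
  show "\<bar>infdist x A - infdist x B\<bar> \<le> r" if "x \<in> ball 0 r" for x
    using infdist_diff_le_norm[OF assms, of x] that by simp
qed

lemma bdd_above_min_inverse:
  "bdd_above ((\<lambda>j::nat. min (1 / real j) (f j)) ` {1..})"
  by (rule bdd_aboveI2[of _ _ 1]) (auto simp: min_le_iff_disj)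

lemma infdist_diff_le_dAW:
  assumes "0 \<in> A" "0 \<in> B" "norm x < real j"
  shows "min (1 / real j) \<bar>infdist x A - infdist x B\<bar> \<le> dAW A B"
proof -
  have j: "j \<in> {1..}" using assms(3) norm_ge_zero[of x] by (cases j) auto
  have "\<bar>infdist x A - infdist x B\<bar> \<le> (SUP x\<in>ball 0 (real j). \<bar>infdist x A - infdist x B\<bar>)"
    using assms by (intro cSUP_upper bdd_above_infdist_diff) auto
  then have "min (1 / real j) \<bar>infdist x A - infdist x B\<bar>
      \<le> min (1 / real j) (SUP x\<in>ball 0 (real j). \<bar>infdist x A - infdist x B\<bar>)"
    by linarith
  also have "\<dots> \<le> dAW A B"
    unfolding dAW_def by (rule cSUP_upper[OF j bdd_above_min_inverse])
  finally show ?thesis .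
qed

lemma dAW_nonneg: "0 \<in> A \<Longrightarrow> 0 \<in> B \<Longrightarrow> 0 \<le> dAW A B"
  using infdist_diff_le_dAW[of A B 0 1] by simp

lemma tendsto_infdist_of_dAW:
  assumes B: "\<And>n. 0 \<in> B n" and A: "0 \<in> A" and lim: "(\<lambda>n. dAW (B n) A) \<longlonglongrightarrow> 0"
  shows "(\<lambda>n. infdist x (B n)) \<longlonglongrightarrow> infdist x A"
proof (rule tendstoI)
  fix e :: real assume "0 < e"
  obtain j where j: "norm x < real j" using reals_Archimedean2 by blast
  then have "0 < real j" using norm_ge_zero[of x] by linarith
  \<comment> \<open>Once \<open>dAW\<close> is below 1/j, the truncation is inactive at radius j, so
    the difference of distances itself is controlled.\<close>
  then have "0 < min (1 / real j) e" using \<open>0 < e\<close> by simp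
  from order_tendstoD(2)[OF lim this]
  show "\<forall>\<^sub>F n in sequentially. dist (infdist x (B n)) (infdist x A) < e"
  proof eventually_elim
    case (elim n)
    then show ?case
      using infdist_diff_le_dAW[OF B A j, of n] by (auto simp: dist_real_def)
  qed
qed

text \<open>Distance functions are 1-Lipschitz, so pointwise convergence is uniform on bounded sets;
  radii j beyond a fixed N are absorbed by the truncation 1/j.\<close>

lemma dAW_tendsto_0:
  fixes A :: "(real^'n) set"
  assumes B: "\<And>n. 0 \<in> B n" and A: "0 \<in> A"
    and lim: "\<And>x. (\<lambda>n. infdist x (B n)) \<longlonglongrightarrow> infdist x A"
  shows "(\<lambda>n. dAW (B n) A) \<longlonglongrightarrow> 0"
proof (rule tendstoI)
  fix e :: real assume e: "0 < e"
  obtain N where N: "N \<noteq> 0" "1 / real N < e / 2"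
    using reals_Archimedean3 e nat_approx_posE[of "e / 2"] by (metis half_gt_zero nat.distinct(1))
  \<comment> \<open>An e/8-net: two Lipschitz errors of e/8 and the error e/4 at a net point add up
    to e/2.\<close>
  obtain F where F: "finite F" "cball 0 (real N) \<subseteq> (\<Union>x\<in>F. ball (x :: real^'n) (e / 8))"
    using e by (metis compact_cball compact_eq_totally_bounded zero_less_divide_iff zero_less_numeral)
  have "\<forall>\<^sub>F n in sequentially. \<forall>x\<in>F. dist (infdist x (B n)) (infdist x A) < e / 4"
    using e by (intro eventually_ball_finite F(1) ballI tendstoD[OF lim]) auto
  then show "\<forall>\<^sub>F n in sequentially. dist (dAW (B n) A) 0 < e"
  proof eventually_elim
    case (elim n)
    have near: "\<bar>infdist x (B n) - infdist x A\<bar> \<le> e / 2" if "norm x \<le> real N" for x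
    proof -
      obtain y where y: "y \<in> F" "dist y x < e / 8" using F(2) \<open>norm x \<le> real N\<close> by fastforce
      have "\<bar>infdist x (B n) - infdist y (B n)\<bar> \<le> dist x y" "\<bar>infdist x A - infdist y A\<bar> \<le> dist x y"
        by (rule infdist_triangle_abs)+
      moreover have "\<bar>infdist y (B n) - infdist y A\<bar> < e / 4"
        using elim y(1) by (auto simp: dist_real_def)
      ultimately show ?thesis using y(2) unfolding dist_commute[of y x] by linarith
    qed
    have "dAW (B n) A \<le> e / 2"
      unfolding dAW_def
    proof (rule cSUP_least)
      fix j :: nat assume j: "j \<in> {1..}"
      show "min (1 / real j) (SUP x\<in>ball 0 (real j). \<bar>infdist x (B n) - infdist x A\<bar>) \<le> e / 2"
      proof (cases "j \<le> N")
        case True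
        have "(SUP x\<in>ball 0 (real j). \<bar>infdist x (B n) - infdist x A\<bar>) \<le> e / 2"
          using j True by (intro cSUP_least near) auto
        then show ?thesis by simp
      next
        case False
        then have "1 / real j \<le> 1 / real N" using N(1) by (intro divide_left_mono) auto
        then show ?thesis using N(2) by simp
      qed
    qed auto
    then show ?case using dAW_nonneg[OF B A, of n] e by simp
  qed
qed

section \<open>Painleve-Kuratowski limits under polarity\<close>

lemma limit_mem_of_tendsto_infdist:
  assumes lim: "\<And>x. (\<lambda>n. infdist x (B n)) \<longlonglongrightarrow> infdist x A"
    and A: "closed A" "A \<noteq> {}"
    and r: "strict_mono r" and y: "\<And>n. y n \<in> B (r n)" and x: "y \<longlonglongrightarrow> x"
  shows "x \<in> A"
proof -
  have "(\<lambda>n. infdist x (B (r n))) \<longlonglongrightarrow> infdist x A"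
    using LIMSEQ_subseq_LIMSEQ[OF lim r] by (simp add: o_def)
  moreover have "(\<lambda>n. dist x (y n)) \<longlonglongrightarrow> 0"
    using tendsto_dist[OF tendsto_const x, of x] by simp
  ultimately have "infdist x A \<le> 0"
    by (rule LIMSEQ_le) (auto intro: infdist_le y)
  then show ?thesis using in_closed_iff_infdist_zero[OF A] infdist_nonneg[of x A] by simp
qed

text \<open>If \<open>y\<close> stayed away from \<open>polar (B n)\<close>, the outer normal at its nearest point there would,
  suitably scaled, be a point of \<open>B n\<close> separating \<open>y\<close>, and so would its limits in \<open>A\<close>. The
  positive constant \<open>h\<close> keeps the scaling bounded.\<close>

lemma polar_lower_limit:
  assumes B: "\<And>n. B n \<in> K0"
    and A: "\<And>r y x. strict_mono r \<Longrightarrow> (\<And>n. y n \<in> B (r n)) \<Longrightarrow> y \<longlonglongrightarrow> x \<Longrightarrow> x \<in> A"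
    and y: "y \<in> polar A"
  shows "(\<lambda>n. infdist y (polar (B n))) \<longlonglongrightarrow> 0"
proof (rule tendstoI, rule ccontr)
  fix e :: real assume e: "0 < e"
  assume "\<not> (\<forall>\<^sub>F n in sequentially. dist (infdist y (polar (B n))) 0 < e)"
  then have "\<not> (\<forall>\<^sub>F n in sequentially. infdist y (polar (B n)) < e)"
    by (simp add: infdist_nonneg)
  then obtain r :: "nat \<Rightarrow> nat" where r: "strict_mono r" "\<And>n. e \<le> infdist y (polar (B (r n)))"
    using not_eventually_sequentiallyD[of "\<lambda>n. infdist y (polar (B n)) < e"] by (auto simp: not_less)
  \<comment> \<open>Below, v . y exceeds v . z by the square of the norm of v, which is at least 2h.
    So the divisor m = max (v . z) h is at least h and still leaves a gap of h below v . y;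
    \<open>M\<close> bounds m from above.\<close>
  define h where "h = e\<^sup>2 / 2"
  define M where "M = (norm y)\<^sup>2 + h"
  have h: "0 < h" and M: "0 < M" using e by (auto simp: h_def M_def add_nonneg_pos)
  have "\<exists>w\<in>B (r n). norm w \<le> norm y / h \<and> 1 + h / M \<le> w \<bullet> y" for n
  proof -
    let ?P = "polar (B (r n))"
    have P: "closed ?P" "convex ?P" "0 \<in> ?P" using polar_in_K0 by (auto simp: K0_def)
    define z where "z = closest_point ?P y"
    define v where "v = y - z"
    have z: "z \<in> ?P" unfolding z_def using P by (intro closest_point_in_set) auto
    have dot: "v \<bullet> (x - z) \<le> 0" if "x \<in> ?P" for x
      unfolding v_def z_def using closest_point_dot[OF P(2,1) that] .
    have c0: "0 \<le> v \<bullet> z" using dot[OF P(3)] by simp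
    have vy: "norm v \<le> norm y"
      using closest_point_le[OF P(1,3), of y] by (simp add: v_def z_def dist_norm)
    have ve: "e \<le> norm v" using r(2)[of n] infdist_le[OF z, of y] by (simp add: v_def dist_norm)
    have yv: "v \<bullet> y = v \<bullet> z + (norm v)\<^sup>2"
      by (simp add: v_def dot_square_norm[symmetric] inner_diff inner_commute)
    define m where "m = max (v \<bullet> z) h"
    have m0: "0 < m" using h by (simp add: m_def)
    have "v \<bullet> y \<le> (norm y)\<^sup>2"
      using norm_cauchy_schwarz[of v y] mult_right_mono[OF vy, of "norm y"]
      by (simp add: power2_eq_square)
    then have "v \<bullet> z \<le> (norm y)\<^sup>2" using yv zero_le_power2[of "norm v"] by linarith
    then have mM: "m \<le> M" using h by (simp add: m_def M_def)
    have "2 * h \<le> (norm v)\<^sup>2" using ve e by (auto simp: h_def intro!: power_mono)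
    then have mv: "m + h \<le> v \<bullet> y" using c0 h yv unfolding m_def by linarith
    show ?thesis
    proof (intro bexI conjI)
      have "norm v / m \<le> norm y / h"
        using vy m0 h by (intro frac_le) (auto simp: m_def)
      then show "norm ((1 / m) *\<^sub>R v) \<le> norm y / h" using m0 by simp
      have "1 + h / M \<le> 1 + h / m" using m0 mM h by (simp add: frac_le)
      also have "\<dots> = (m + h) / m" using m0 by (simp add: field_simps)
      also have "\<dots> \<le> (v \<bullet> y) / m" using m0 mv by (simp add: divide_right_mono)
      finally show "1 + h / M \<le> ((1 / m) *\<^sub>R v) \<bullet> y" by simp
      \<comment> \<open>On \<open>?P\<close>, v is at most v . z, hence at most m; so v / m lies in
        the bipolar, which is \<open>B (r n)\<close>.\<close>
      have "x \<bullet> ((1 / m) *\<^sub>R v) \<le> 1" if "x \<in> ?P" for x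
        using dot[OF that] m0 by (auto simp: inner_diff_right inner_commute m_def)
      then have "(1 / m) *\<^sub>R v \<in> polar ?P" by (simp add: mem_polar_iff)
      then show "(1 / m) *\<^sub>R v \<in> B (r n)" using bipolar[OF B] by simp
    qed
  qed
  then obtain w where w: "\<And>n. w n \<in> B (r n)" "\<And>n. norm (w n) \<le> norm y / h"
      "\<And>n. 1 + h / M \<le> w n \<bullet> y" by metis
  obtain l s where s: "strict_mono s" "(w \<circ> s) \<longlonglongrightarrow> l"
    using compact_cball[of 0 "norm y / h"] w(2) unfolding compact_def
    by (metis mem_cball_0)
  have "l \<in> A" using A[of "r \<circ> s" "w \<circ> s"] s r(1) w(1) by (simp add: strict_mono_o)
  then have "l \<bullet> y \<le> 1" using y by (simp add: mem_polar_iff)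
  moreover have "1 + h / M \<le> l \<bullet> y"
    by (rule LIMSEQ_le_const[OF tendsto_inner[OF s(2) tendsto_const]]) (simp add: w(3))
  ultimately show False using h M by (smt (verit) divide_pos_pos)
qed

text \<open>The lower half for the polars gives the upper half for the sets: nearest points of y in
  the polars pair with \<open>x n\<close> to at most 1, and this passes to the limit, putting l in
  the bipolar of A.\<close>

lemma mem_of_polar_lower_limit:
  assumes A: "A \<in> K0"
    and lim: "\<And>y. y \<in> polar A \<Longrightarrow> (\<lambda>n. infdist y (polar (B n))) \<longlonglongrightarrow> 0"
    and r: "strict_mono r" and x: "\<And>n. x n \<in> B (r n)" "x \<longlonglongrightarrow> l"
  shows "l \<in> A"
proof -
  have "l \<in> polar (polar A)"
    unfolding mem_polar_iff
  proof
    fix y assume "y \<in> polar A"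
    have "\<exists>z\<in>polar (B n). infdist y (polar (B n)) = dist y z" for n
      using infdist_attains_inf[of "polar (B n)" y] polar_in_K0[of "B n"]
      by (auto simp: K0_def)
    then obtain z where z: "\<And>n. z n \<in> polar (B n)" "\<And>n. infdist y (polar (B n)) = dist y (z n)"
      by metis
    have "z \<longlonglongrightarrow> y"
      using lim[OF \<open>y \<in> polar A\<close>] unfolding z(2) tendsto_dist_iff[of z] by (simp add: dist_commute)
    then have "(\<lambda>n. z (r n)) \<longlonglongrightarrow> y" using LIMSEQ_subseq_LIMSEQ[OF _ r] by (simp add: o_def)
    then have "(\<lambda>n. z (r n) \<bullet> x n) \<longlonglongrightarrow> y \<bullet> l" by (intro tendsto_intros x)
    moreover have "z (r n) \<bullet> x n \<le> 1" for n
      using z(1)[of "r n"] x(1)[of n] by (auto simp: mem_polar_iff inner_commute)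
    ultimately show "y \<bullet> l \<le> 1" by (intro LIMSEQ_le_const2) auto
  qed
  then show ?thesis using bipolar[OF A] by simp
qed

text \<open>The lower half bounds the limsup of the distances through a nearest point of A. The
  upper half bounds the liminf: along a bad subsequence, nearest points stay in a ball and
  accumulate in A.\<close>

lemma tendsto_infdist_of_limits:
  fixes A :: "(real^'n) set"
  assumes B: "\<And>n. closed (B n)" "\<And>n. B n \<noteq> {}" and A: "closed A" "A \<noteq> {}"
    and lower: "\<And>x. x \<in> A \<Longrightarrow> (\<lambda>n. infdist x (B n)) \<longlonglongrightarrow> 0"
    and upper: "\<And>r y x. strict_mono r \<Longrightarrow> (\<And>n. y n \<in> B (r n)) \<Longrightarrow> y \<longlonglongrightarrow> x \<Longrightarrow> x \<in> A"
  shows "(\<lambda>n. infdist x (B n)) \<longlonglongrightarrow> infdist x A"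
proof (rule order_tendstoI)
  fix a assume a: "infdist x A < a"
  obtain c where c: "c \<in> A" "infdist x A = dist x c" using infdist_attains_inf[OF A] by blast
  have "\<forall>\<^sub>F n in sequentially. infdist c (B n) < a - dist x c"
    using a c by (intro order_tendstoD(2)[OF lower]) auto
  then show "\<forall>\<^sub>F n in sequentially. infdist x (B n) < a"
  proof eventually_elim
    case (elim n)
    then show ?case using infdist_triangle[of x "B n" c] by linarith
  qed
next
  fix a assume a: "a < infdist x A"
  show "\<forall>\<^sub>F n in sequentially. a < infdist x (B n)"
  proof (rule ccontr)
    assume "\<not> ?thesis"
    then obtain r :: "nat \<Rightarrow> nat" where r: "strict_mono r" "\<And>n. infdist x (B (r n)) \<le> a"
      using not_eventually_sequentiallyD[of "\<lambda>n. a < infdist x (B n)"] by (auto simp: not_less)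
    have "\<exists>y\<in>B (r n). dist x y \<le> a" for n
      using infdist_attains_inf[OF B, of "r n" x] r(2)[of n] by metis
    then obtain y where y: "\<And>n. y n \<in> B (r n)" "\<And>n. y n \<in> cball x a" by (metis mem_cball)
    obtain l s where s: "l \<in> cball x a" "strict_mono s" "(y \<circ> s) \<longlonglongrightarrow> l"
      using compact_cball[of x a, unfolded compact_def, rule_format, of y] y(2) by blast
    have "l \<in> A" using upper[of "r \<circ> s" "y \<circ> s"] s r(1) y(1) by (simp add: strict_mono_o)
    then show False using infdist_le[of l A x] s(1) a by simp
  qed
qed

section \<open>Joint continuity of the contraction\<close>

lemma prox_shrink_lower_limit:
  fixes A :: "(real^'n) set"
  assumes A: "A \<in> K0" and B: "\<And>n. B n \<in> K0"
    and lower: "\<And>x. x \<in> A \<Longrightarrow> (\<lambda>n. infdist x (B n)) \<longlonglongrightarrow> 0"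
    and s: "s \<longlonglongrightarrow> t" and x: "x \<in> prox_shrink A t"
  shows "(\<lambda>n. infdist x (prox_shrink (B n) (s n))) \<longlonglongrightarrow> 0"
proof (rule tendstoI)
  fix e :: real assume e: "0 < e"
  obtain a b r where x_eq: "x = (1 - t) *\<^sub>R a + t *\<^sub>R b" and a: "gauge_le A a r"
      and E: "prox_energy t a b r \<le> 1"
    using x by (auto simp: prox_shrink_def)
  have "((\<lambda>c. dist x (c *\<^sub>R x)) \<longlongrightarrow> dist x (1 *\<^sub>R x)) (at_left 1)"
    by (intro tendsto_intros)
  then have "\<forall>\<^sub>F c in at_left (1::real). dist x (c *\<^sub>R x) < e"
    using e by (intro order_tendstoD(2)) auto
  moreover have "\<forall>\<^sub>F c in at_left (1::real). 0 < c \<and> c < 1"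
    using eventually_at_left_real[of 0 "1::real"] by (auto elim: eventually_mono)
  ultimately have "\<forall>\<^sub>F c in at_left (1::real). dist x (c *\<^sub>R x) < e \<and> 0 < c \<and> c < 1"
    by eventually_elim auto
  from eventually_happens'[OF _ this] obtain c :: real
    where c: "dist x (c *\<^sub>R x) < e" "0 < c" "c < 1" by auto
  have "c\<^sup>2 * prox_energy t a b r \<le> c\<^sup>2 * 1" using E by (intro mult_left_mono) auto
  also have "\<dots> < 1" using c by (simp add: power_less_one_iff)
  finally have "prox_energy t (c *\<^sub>R a) (c *\<^sub>R b) (c * r + 0) < 1"
    by (simp add: prox_energy_scale)
  moreover have "((\<lambda>h. prox_energy t (c *\<^sub>R a) (c *\<^sub>R b) (c * r + h))
      \<longlongrightarrow> prox_energy t (c *\<^sub>R a) (c *\<^sub>R b) (c * r + 0)) (at_right 0)"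
    unfolding prox_energy_def by (intro tendsto_intros)
  ultimately have "\<forall>\<^sub>F h in at_right 0. prox_energy t (c *\<^sub>R a) (c *\<^sub>R b) (c * r + h) < 1"
    by (intro order_tendstoD(2))
  then have "\<forall>\<^sub>F h in at_right 0. prox_energy t (c *\<^sub>R a) (c *\<^sub>R b) (c * r + h) < 1 \<and> 0 < h"
    using eventually_at_right_less[of "0::real"] by eventually_elim auto
  from eventually_happens'[OF _ this] obtain h where
    h: "prox_energy t (c *\<^sub>R a) (c *\<^sub>R b) (c * r + h) < 1" "0 < h" by auto
  \<comment> \<open>Shrinking by \<open>c\<close> leaves room to perturb; \<open>h\<close> covers points of gauge zero.\<close>
  define q where "q = c * r + h"
  have q: "0 < q" using gauge_le_nonneg[OF a] c h(2) by (simp add: q_def add_nonneg_pos)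
  have "gauge_le A (c *\<^sub>R a) q"
    using gauge_le_mono[OF gauge_le_scale[OF a, of c], of q] c(2) h(2) by (simp add: q_def)
  then have mem: "(1 / q) *\<^sub>R (c *\<^sub>R a) \<in> A" by (rule gauge_le_mem_scaled[OF A _ q])
  \<comment> \<open>Nearest points in \<open>B n\<close> replace the rescaled a, while b is kept.
    Then \<open>q *\<^sub>R w n\<close> has gauge at most q for \<open>B n\<close>, and the strict
    energy bound survives for large n.\<close>
  have "\<exists>w\<in>B n. infdist ((1 / q) *\<^sub>R (c *\<^sub>R a)) (B n) = dist ((1 / q) *\<^sub>R (c *\<^sub>R a)) w" for n
    using infdist_attains_inf[of "B n"] B[of n] by (auto simp: K0_def)
  then obtain w where w: "\<And>n. w n \<in> B n"
    "\<And>n. infdist ((1 / q) *\<^sub>R (c *\<^sub>R a)) (B n) = dist ((1 / q) *\<^sub>R (c *\<^sub>R a)) (w n)" by metis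
  have "w \<longlonglongrightarrow> (1 / q) *\<^sub>R (c *\<^sub>R a)"
    using lower[OF mem] unfolding w(2) tendsto_dist_iff[of w] by (simp add: dist_commute)
  from tendsto_scaleR[OF tendsto_const this, of q]
  have wlim: "(\<lambda>n. q *\<^sub>R w n) \<longlonglongrightarrow> c *\<^sub>R a" using q by simp
  have "(\<lambda>n. prox_energy (s n) (q *\<^sub>R w n) (c *\<^sub>R b) q) \<longlonglongrightarrow> prox_energy t (c *\<^sub>R a) (c *\<^sub>R b) q"
    unfolding prox_energy_def by (intro tendsto_intros s wlim)
  then have ev1: "\<forall>\<^sub>F n in sequentially. prox_energy (s n) (q *\<^sub>R w n) (c *\<^sub>R b) q < 1"
    using h(1) unfolding q_def by (rule order_tendstoD(2))
  have "(\<lambda>n. dist x ((1 - s n) *\<^sub>R (q *\<^sub>R w n) + s n *\<^sub>R (c *\<^sub>R b)))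
      \<longlonglongrightarrow> dist x ((1 - t) *\<^sub>R (c *\<^sub>R a) + t *\<^sub>R (c *\<^sub>R b))"
    by (intro tendsto_intros s wlim)
  also have "(1 - t) *\<^sub>R (c *\<^sub>R a) + t *\<^sub>R (c *\<^sub>R b) = c *\<^sub>R x"
    by (simp add: x_eq scaleR_add_right mult.commute)
  finally have ev2: "\<forall>\<^sub>F n in sequentially. dist x ((1 - s n) *\<^sub>R (q *\<^sub>R w n) + s n *\<^sub>R (c *\<^sub>R b)) < e"
    using c(1) by (rule order_tendstoD(2))
  from ev1 ev2 show "\<forall>\<^sub>F n in sequentially. dist (infdist x (prox_shrink (B n) (s n))) 0 < e"
  proof eventually_elim
    case (elim n)
    have "gauge_le (B n) (q *\<^sub>R w n) q"
      using gauge_le_scale[OF gauge_le_mem[OF w(1)], of q n] q by simp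
    from prox_shrinkI[OF this, of "s n" "c *\<^sub>R b"] elim(1)
    have "(1 - s n) *\<^sub>R (q *\<^sub>R w n) + s n *\<^sub>R (c *\<^sub>R b) \<in> prox_shrink (B n) (s n)" by simp
    from infdist_le[OF this, of x] elim(2) show ?case by (simp add: infdist_nonneg)
  qed
qed

lemma dAW_prox_shrink_tendsto_0:
  fixes A :: "(real^'n) set"
  assumes A: "A \<in> K0" and B: "\<And>n. B n \<in> K0"
    and t: "t \<in> {0..1}" and s: "\<And>n. s n \<in> {0..1}"
    and lim: "(\<lambda>n. dAW (B n) A) \<longlonglongrightarrow> 0" and st: "s \<longlonglongrightarrow> t"
  shows "(\<lambda>n. dAW (prox_shrink (B n) (s n)) (prox_shrink A t)) \<longlonglongrightarrow> 0"
proof -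
  have A': "closed A" "0 \<in> A" "A \<noteq> {}" and B': "0 \<in> B n" for n
    using A B by (auto simp: K0_def)
  have inf: "(\<lambda>n. infdist x (B n)) \<longlonglongrightarrow> infdist x A" for x
    by (rule tendsto_infdist_of_dAW[OF B' A'(2) lim])
  have lower: "(\<lambda>n. infdist x (B n)) \<longlonglongrightarrow> 0" if "x \<in> A" for x
    using inf[of x] that by simp
  have plower: "(\<lambda>n. infdist y (polar (B n))) \<longlonglongrightarrow> 0" if "y \<in> polar A" for y
    by (rule polar_lower_limit[OF B limit_mem_of_tendsto_infdist[OF inf A'(1,3)] that])
  let ?A = "prox_shrink A t" and ?B = "\<lambda>n. prox_shrink (B n) (s n)"
  have K: "?A \<in> K0" "?B n \<in> K0" for n
    using prox_shrink_in_K0 A B t s by auto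
  have 1: "(\<lambda>n. infdist x (?B n)) \<longlonglongrightarrow> 0" if "x \<in> ?A" for x
    by (rule prox_shrink_lower_limit[OF A B lower st that])
  \<comment> \<open>By equivariance the polars of the averages are the averages of the polars, so
    the same lower-limit lemma applies; this yields the upper half for the averages.\<close>
  have 2: "(\<lambda>n. infdist y (polar (?B n))) \<longlonglongrightarrow> 0" if "y \<in> polar ?A" for y
    using prox_shrink_lower_limit[of "polar A" "\<lambda>n. polar (B n)", OF polar_in_K0 polar_in_K0 plower st] that
    unfolding prox_shrink_polar[OF A t] prox_shrink_polar[OF B s] by blast
  show ?thesis
  proof (rule dAW_tendsto_0)
    show "(\<lambda>n. infdist x (?B n)) \<longlonglongrightarrow> infdist x ?A" for x
      by (rule tendsto_infdist_of_limits[OF _ _ _ _ 1 mem_of_polar_lower_limit[OF K(1) 2]])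
        (use K in \<open>auto simp: K0_def\<close>)
  qed (use K in \<open>auto simp: K0_def\<close>)
qed

lemma prox_shrink_continuous:
  fixes A :: "(real^'n) set"
  assumes A: "A \<in> K0" and t: "t \<in> {0..1}" and e: "0 < e"
  shows "\<exists>d>0. \<forall>B\<in>K0. \<forall>s\<in>{0..1}. dAW B A < d \<and> \<bar>s - t\<bar> < d
      \<longrightarrow> dAW (prox_shrink B s) (prox_shrink A t) < e"
proof (rule ccontr)
  assume neg: "\<not> ?thesis"
  \<comment> \<open>Failure for every delta of the form 1/(n+1) produces sequences that contradict
    sequential continuity.\<close>
  have "\<exists>B s. B \<in> K0 \<and> s \<in> {0..1} \<and> dAW B A < inverse (Suc n) \<and> \<bar>s - t\<bar> < inverse (Suc n)
      \<and> e \<le> dAW (prox_shrink B s) (prox_shrink A t)" for n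
  proof -
    have "0 < inverse (real (Suc n))" by simp
    with neg show ?thesis by (meson not_less)
  qed
  then obtain B s where B: "\<And>n. B n \<in> K0" "\<And>n. s n \<in> {0..1}"
      "\<And>n. dAW (B n) A < inverse (Suc n)" "\<And>n. \<bar>s n - t\<bar> < inverse (Suc n)"
      "\<And>n. e \<le> dAW (prox_shrink (B n) (s n)) (prox_shrink A t)"
    by metis
  have "(\<lambda>n. dAW (B n) A) \<longlonglongrightarrow> 0"
  proof (rule tendsto_sandwich[OF _ _ tendsto_const LIMSEQ_inverse_real_of_nat])
    show "\<forall>\<^sub>F n in sequentially. 0 \<le> dAW (B n) A"
      using A B(1) by (intro always_eventually allI dAW_nonneg) (auto simp: K0_def)
    show "\<forall>\<^sub>F n in sequentially. dAW (B n) A \<le> inverse (Suc n)"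
      by (intro always_eventually allI less_imp_le B(3))
  qed
  moreover have "s \<longlonglongrightarrow> t"
  proof (rule LIM_zero_cancel, rule Lim_null_comparison[OF _ LIMSEQ_inverse_real_of_nat])
    show "\<forall>\<^sub>F n in sequentially. norm (s n - t) \<le> inverse (Suc n)"
      unfolding real_norm_def by (intro always_eventually allI less_imp_le B(4))
  qed
  ultimately have "(\<lambda>n. dAW (prox_shrink (B n) (s n)) (prox_shrink A t)) \<longlonglongrightarrow> 0"
    by (rule dAW_prox_shrink_tendsto_0[OF A B(1) t B(2)])
  then have "e \<le> 0" by (rule LIMSEQ_le_const) (simp add: B(5))
  then show False using e by simp
qed

theorem theorem4p3:
  assumes "CARD('n) \<ge> 2"
  shows "\<exists>\<phi> :: (real^'n) set \<Rightarrow> real \<Rightarrow> (real^'n) set.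
    (\<forall>A\<in>K0. \<forall>t\<in>{0..1}. \<phi> A t \<in> K0) \<and>
    (\<forall>A\<in>K0. \<forall>t\<in>{0..1}. \<forall>\<epsilon>>0. \<exists>\<delta>>0. \<forall>B\<in>K0. \<forall>s\<in>{0..1}.
        dAW B A < \<delta> \<and> \<bar>s - t\<bar> < \<delta> \<longrightarrow> dAW (\<phi> B s) (\<phi> A t) < \<epsilon>) \<and>
    (\<forall>A\<in>K0. \<phi> A 0 = A \<and> \<phi> A 1 = cball 0 1) \<and>
    (\<forall>A\<in>K0. \<forall>t\<in>{0..1}. \<phi> (polar A) t = polar (\<phi> A t))"
proof (rule exI[of _ prox_shrink], intro conjI ballI allI impI)
  fix A :: "(real^'n) set" and t :: real
  assume A: "A \<in> K0"
  show "prox_shrink A 0 = A" using A by (rule prox_shrink_0)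
  show "prox_shrink A 1 = cball 0 1" using A by (simp add: prox_shrink_1 K0_def)
  assume t: "t \<in> {0..1}"
  show "prox_shrink A t \<in> K0" using A t by (rule prox_shrink_in_K0)
  show "prox_shrink (polar A) t = polar (prox_shrink A t)" using A t by (rule prox_shrink_polar)
  show "\<exists>\<delta>>0. \<forall>B\<in>K0. \<forall>s\<in>{0..1}. dAW B A < \<delta> \<and> \<bar>s - t\<bar> < \<delta> \<longrightarrow>
      dAW (prox_shrink B s) (prox_shrink A t) < e" if "0 < e" for e
    using A t that by (rule prox_shrink_continuous)
qed

end
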